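(* Assume the Generalized Continuum Hypothesis. Let $G$ be a paratopological group. If $G$ contains a subspace homeomorphic to a stationary subset of some uncountable regular cardinal, then $G$ is not hereditarily normal.
   Context: All spaces are Tychonoff. A paratopological group is a group endowed with a topology for which the group multiplication $G\times G\to G$ is (jointly) continuous. Subsets of ordinals carry the subspace topology of the order topology. A subset of a regular uncountable cardinal $\kappa$ is stationary if it meets every closed unbounded subset of $\kappa$. *)

theory Defs
  imports "HOL-Analysis.Analysis" "HOL-Library.Equipollence" "HOL-Algebra.Group"
begin

definition GCH_on :: "'u set \<Rightarrow> bool" where
  "GCH_on U \<longleftrightarrow>
     (\<forall>A\<subseteq>U. \<forall>B\<subseteq>U. infinite A \<longrightarrow> \<not> (A \<prec> B \<and> B \<prec> Pow A))"

definition rless :: "'k rel \<Rightarrow> 'k \<Rightarrow> 'k \<Rightarrow> bool" where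
  "rless r x y \<longleftrightarrow> (x, y) \<in> r \<and> x \<noteq> y"

definition ord_open :: "'k rel \<Rightarrow> 'k set \<Rightarrow> bool" where
  "ord_open r U \<longleftrightarrow> U \<subseteq> Field r \<and>
     (\<forall>x\<in>U.
        ((\<forall>y\<in>Field r. (x, y) \<in> r) \<or>
           (\<exists>a\<in>Field r. rless r a x \<and> {y\<in>Field r. rless r a y \<and> (y, x) \<in> r} \<subseteq> U)) \<and>
        ((\<forall>y\<in>Field r. (y, x) \<in> r) \<or>
           (\<exists>b\<in>Field r. rless r x b \<and> {y\<in>Field r. (x, y) \<in> r \<and> rless r y b} \<subseteq> U)))"

definition ord_topology :: "'k rel \<Rightarrow> 'k topology" where
  "ord_topology r = topology (ord_open r)"

definition club :: "'k rel \<Rightarrow> 'k set \<Rightarrow> bool" where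
  "club r C \<longleftrightarrow> C \<subseteq> Field r \<and> closedin (ord_topology r) C \<and>
     (\<forall>x\<in>Field r. \<exists>y\<in>C. rless r x y)"

definition stationary :: "'k rel \<Rightarrow> 'k set \<Rightarrow> bool" where
  "stationary r S \<longleftrightarrow> S \<subseteq> Field r \<and> (\<forall>C. club r C \<longrightarrow> S \<inter> C \<noteq> {})"

definition regular_uncountable_cardinal :: "'k rel \<Rightarrow> bool" where
  "regular_uncountable_cardinal r \<longleftrightarrow>
     Card_order r \<and> regularCard r \<and> uncountable (Field r)"

definition tychonoff_space :: "'a topology \<Rightarrow> bool" where
  "tychonoff_space X \<longleftrightarrow> completely_regular_space X \<and> t1_space X"

definition paratopological_group :: "('g, 'b) monoid_scheme \<Rightarrow> 'g topology \<Rightarrow> bool" where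
  "paratopological_group G T \<longleftrightarrow> group G \<and> topspace T = carrier G \<and>
     continuous_map (prod_topology T T) T (\<lambda>(x, y). x \<otimes>\<^bsub>G\<^esub> y)"

end

theory Submission
  imports Defs "HOL-Library.Countable_Set_Type"
begin

text \<open>Let \<open>s\<^sub>0\<close> be a limit point of \<open>S\<close> in \<open>S\<close>. The translates of the points of \<open>S\<close> below \<open>s\<^sub>0\<close> converge
  to the identity, so hereditary normality forces, by Katetov's argument, the identity to be the
  intersection of fewer than \<open>\<kappa>\<close> neighbourhoods \<open>W\<^sub>i\<close>. Choose \<open>V\<^sub>i\<close> with \<open>V\<^sub>i V\<^sub>i \<subseteq> W\<^sub>i\<close>. Pressing down
  gives \<open>d\<^sub>i < \<kappa>\<close> such that, for unboundedly many \<open>t\<close> in \<open>S\<close>, the set \<open>t V\<^sub>i\<close> contains all points of \<open>S\<close> in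
  \<open>(d\<^sub>i, t]\<close>. If \<open>u\<close> in \<open>S\<close> exceeds all \<open>d\<^sub>i\<close> and \<open>s > u\<close> in \<open>S\<close> is a limit of such \<open>t\<close> for every \<open>i\<close>, then
  \<open>u \<in> t V\<^sub>i\<close> and \<open>t \<in> s V\<^sub>i\<close> for some \<open>t\<close>, hence \<open>u \<in> s W\<^sub>i\<close> for all \<open>i\<close>, and \<open>u = s\<close>.\<close>

unbundle cardinal_syntax

section \<open>Order and cardinality in a regular uncountable cardinal\<close>

locale regular_uncountable =
  fixes r :: "'k rel"
  assumes kappa: "regular_uncountable_cardinal r"
begin

lemma card_order: "Card_order r"
  and regular: "regularCard r"
  and uncountable: "uncountable (Field r)"
  using kappa unfolding regular_uncountable_cardinal_def by auto

lemma well_order: "Well_order r"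
  using card_order by (rule card_order_on_well_order_on)

lemma infinite_Field: "infinite (Field r)"
  using uncountable countable_finite by blast

lemma rless_Field: "rless r x y \<Longrightarrow> x \<in> Field r" "rless r x y \<Longrightarrow> y \<in> Field r"
  unfolding rless_def by (auto intro: FieldI1 FieldI2)

lemma le_Field: "(x, y) \<in> r \<Longrightarrow> x \<in> Field r" "(x, y) \<in> r \<Longrightarrow> y \<in> Field r"
  by (auto intro: FieldI1 FieldI2)

lemma le_refl: "x \<in> Field r \<Longrightarrow> (x, x) \<in> r"
  using well_order unfolding well_order_on_def linear_order_on_def partial_order_on_def
    preorder_on_def refl_on_def by auto

lemma le_trans: "(x, y) \<in> r \<Longrightarrow> (y, z) \<in> r \<Longrightarrow> (x, z) \<in> r"
  using well_order unfolding well_order_on_def linear_order_on_def partial_order_on_def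
    preorder_on_def by (blast dest: transD)

lemma le_antisym: "(x, y) \<in> r \<Longrightarrow> (y, x) \<in> r \<Longrightarrow> x = y"
  using well_order unfolding well_order_on_def linear_order_on_def partial_order_on_def
  by (blast dest: antisymD)

lemma rless_irrefl: "\<not> rless r x x"
  unfolding rless_def by simp

lemma rless_imp_le: "rless r x y \<Longrightarrow> (x, y) \<in> r"
  unfolding rless_def by simp

lemma rless_le_trans: "rless r x y \<Longrightarrow> (y, z) \<in> r \<Longrightarrow> rless r x z"
  unfolding rless_def using le_trans le_antisym by blast

lemma le_rless_trans: "(x, y) \<in> r \<Longrightarrow> rless r y z \<Longrightarrow> rless r x z"
  unfolding rless_def using le_trans le_antisym by blast

lemma rless_trans: "rless r x y \<Longrightarrow> rless r y z \<Longrightarrow> rless r x z"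
  using rless_le_trans rless_imp_le by blast

lemma not_rless: "x \<in> Field r \<Longrightarrow> y \<in> Field r \<Longrightarrow> \<not> rless r x y \<longleftrightarrow> (y, x) \<in> r"
proof -
  assume xy: "x \<in> Field r" "y \<in> Field r"
  then have "x = y \<or> (x, y) \<in> r \<or> (y, x) \<in> r"
    using well_order unfolding well_order_on_def linear_order_on_def total_on_def by blast
  then show ?thesis
    using xy le_refl le_antisym unfolding rless_def by blast
qed

lemma upper_pair:
  assumes "x \<in> Field r" "y \<in> Field r"
  obtains z where "z \<in> {x, y}" "(x, z) \<in> r" "(y, z) \<in> r"
  using assms not_rless le_refl rless_imp_le by (metis insertCI)

lemma lower_pair:
  assumes "x \<in> Field r" "y \<in> Field r"
  obtains z where "z \<in> {x, y}" "(z, x) \<in> r" "(z, y) \<in> r"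
  using assms not_rless le_refl rless_imp_le by (metis insertCI)

lemma no_maximum: "x \<in> Field r \<Longrightarrow> \<exists>y. rless r x y"
  using infinite_Card_order_limit[OF card_order infinite_Field] unfolding rless_def by blast

lemma ex_least:
  assumes "x \<in> A" "A \<subseteq> Field r"
  obtains m where "m \<in> A" "\<And>y. rless r y m \<Longrightarrow> y \<notin> A"
proof -
  have "wf (r - Id)"
    using well_order unfolding well_order_on_def by simp
  then obtain m where "m \<in> A" "\<And>y. (y, m) \<in> r - Id \<Longrightarrow> y \<notin> A"
    using assms(1) by (metis wf_eq_minimal)
  then show ?thesis
    using that unfolding rless_def by auto
qed

lemma successor:
  assumes "x \<in> Field r"
  obtains y where "rless r x y" "\<And>z. rless r z y \<Longrightarrow> (z, x) \<in> r"
proof -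
  obtain w where "rless r x w"
    using no_maximum[OF assms] by blast
  then obtain y where y: "rless r x y" "\<And>z. rless r z y \<Longrightarrow> \<not> rless r x z"
    using ex_least[of w "{y. rless r x y}"] rless_Field(2) by (metis mem_Collect_eq subsetI)
  then show ?thesis
    using that not_rless[OF assms] rless_Field by blast
qed

text \<open>By regularity a cofinal set has the full cardinality of \<open>r\<close>, so
  \<open>A\<close> is not cofinal and some \<open>c\<close> is a weak upper bound; as there is no
  maximum, a point above \<open>c\<close> bounds strictly.\<close>

lemma strict_bound:
  assumes "A \<subseteq> Field r" "|A| <o r"
  obtains b where "b \<in> Field r" "\<And>a. a \<in> A \<Longrightarrow> rless r a b"
proof -
  have "\<not> cofinal A r"
    using assms regular not_ordLess_ordIso unfolding regularCard_def by blast
  then obtain c where c: "c \<in> Field r" "\<And>a. a \<in> A \<Longrightarrow> \<not> rless r c a"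
    unfolding cofinal_def rless_def by blast
  obtain b where "rless r c b"
    using no_maximum[OF c(1)] by blast
  then have "b \<in> Field r" "\<And>a. a \<in> A \<Longrightarrow> rless r a b"
    using c assms(1) not_rless le_rless_trans rless_Field by blast+
  then show ?thesis
    using that by blast
qed

lemma strict_bound_image:
  assumes "f ` I \<subseteq> Field r" "|I| <o r"
  obtains b where "b \<in> Field r" "\<And>i. i \<in> I \<Longrightarrow> rless r (f i) b"
  using strict_bound[OF assms(1)] card_of_image assms(2) ordLeq_ordLess_trans by (metis image_eqI)

text \<open>Together with \<open>strict_bound\<close> this bounds countable sets, so that iterations
  of length omega stay below the cardinal.\<close>

lemma countable_less: "countable A \<Longrightarrow> |A| <o r"
proof -
  assume A: "countable A"
  have "\<not> |Field r| \<le>o |A|"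
  proof
    assume "|Field r| \<le>o |A|"
    then have "|Field r| \<le>o natLeq"
      using A unfolding countable_card_le_natLeq by (rule ordLeq_transitive)
    then show False
      using uncountable unfolding countable_card_le_natLeq by contradiction
  qed
  then have "|A| <o |Field r|"
    by (simp add: card_of_Well_order not_ordLeq_iff_ordLess)
  then show ?thesis
    using card_of_Field_ordIso[OF card_order] ordLess_ordIso_trans by blast
qed

lemma card_below: "x \<in> Field r \<Longrightarrow> |{y. rless r y x}| <o r"
  using card_of_underS[OF card_order, of x] unfolding underS_def rless_def
  by (simp add: conj_commute)

section \<open>The order topology\<close>

lemma istopology_ord_open: "istopology (ord_open r)"
proof -
  have "ord_open r (U \<inter> V)" if U: "ord_open r U" and V: "ord_open r V" for U V
    unfolding ord_open_def
  proof (intro conjI ballI)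
    show "U \<inter> V \<subseteq> Field r"
      using U unfolding ord_open_def by blast
    fix x assume x: "x \<in> U \<inter> V"
    show "(\<forall>y\<in>Field r. (x, y) \<in> r) \<or>
        (\<exists>a\<in>Field r. rless r a x \<and> {y \<in> Field r. rless r a y \<and> (y, x) \<in> r} \<subseteq> U \<inter> V)"
    proof (rule disjCI)
      assume n: "\<not> (\<exists>a\<in>Field r. rless r a x \<and> {y \<in> Field r. rless r a y \<and> (y, x) \<in> r} \<subseteq> U \<inter> V)"
      show "\<forall>y\<in>Field r. (x, y) \<in> r"
      proof (rule ccontr)
        assume m: "\<not> (\<forall>y\<in>Field r. (x, y) \<in> r)"
        obtain a where a: "a \<in> Field r" "rless r a x" "{y \<in> Field r. rless r a y \<and> (y, x) \<in> r} \<subseteq> U"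
          using m U x unfolding ord_open_def by blast
        obtain b where b: "b \<in> Field r" "rless r b x" "{y \<in> Field r. rless r b y \<and> (y, x) \<in> r} \<subseteq> V"
          using m V x unfolding ord_open_def by blast
        \<comment> \<open>The larger of the two left endpoints serves both \<open>U\<close> and
          \<open>V\<close>; on the right side it is the smaller one.\<close>
        obtain c where c: "c \<in> {a, b}" "(a, c) \<in> r" "(b, c) \<in> r"
          using upper_pair a b by metis
        have "{y \<in> Field r. rless r c y \<and> (y, x) \<in> r} \<subseteq> U \<inter> V"
          using a b c le_rless_trans by blast
        then show False
          using n a b c by blast
      qed
    qed
    show "(\<forall>y\<in>Field r. (y, x) \<in> r) \<or>
        (\<exists>b\<in>Field r. rless r x b \<and> {y \<in> Field r. (x, y) \<in> r \<and> rless r y b} \<subseteq> U \<inter> V)"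
    proof (rule disjCI)
      assume n: "\<not> (\<exists>b\<in>Field r. rless r x b \<and> {y \<in> Field r. (x, y) \<in> r \<and> rless r y b} \<subseteq> U \<inter> V)"
      show "\<forall>y\<in>Field r. (y, x) \<in> r"
      proof (rule ccontr)
        assume m: "\<not> (\<forall>y\<in>Field r. (y, x) \<in> r)"
        obtain a where a: "a \<in> Field r" "rless r x a" "{y \<in> Field r. (x, y) \<in> r \<and> rless r y a} \<subseteq> U"
          using m U x unfolding ord_open_def by blast
        obtain b where b: "b \<in> Field r" "rless r x b" "{y \<in> Field r. (x, y) \<in> r \<and> rless r y b} \<subseteq> V"
          using m V x unfolding ord_open_def by blast
        obtain c where c: "c \<in> {a, b}" "(c, a) \<in> r" "(c, b) \<in> r"
          using lower_pair a b by metis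
        have "{y \<in> Field r. (x, y) \<in> r \<and> rless r y c} \<subseteq> U \<inter> V"
          using a b c rless_le_trans by blast
        then show False
          using n a b c by blast
      qed
    qed
  qed
  moreover have "ord_open r (\<Union>\<K>)" if "\<forall>K\<in>\<K>. ord_open r K" for \<K>
    unfolding ord_open_def
  proof (intro conjI ballI)
    show "\<Union>\<K> \<subseteq> Field r"
      using that unfolding ord_open_def by blast
    fix x assume "x \<in> \<Union>\<K>"
    then obtain K where K: "x \<in> K" "K \<in> \<K>"
      by blast
    then have "ord_open r K" "K \<subseteq> \<Union>\<K>"
      using that by auto
    then show "(\<forall>y\<in>Field r. (x, y) \<in> r) \<or>
        (\<exists>a\<in>Field r. rless r a x \<and> {y \<in> Field r. rless r a y \<and> (y, x) \<in> r} \<subseteq> \<Union>\<K>)"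
      and "(\<forall>y\<in>Field r. (y, x) \<in> r) \<or>
        (\<exists>b\<in>Field r. rless r x b \<and> {y \<in> Field r. (x, y) \<in> r \<and> rless r y b} \<subseteq> \<Union>\<K>)"
      using K(1) unfolding ord_open_def by (meson subset_trans)+
  qed
  ultimately show ?thesis
    unfolding istopology_def by blast
qed

lemma openin_ord_topology: "openin (ord_topology r) = ord_open r"
  unfolding ord_topology_def using istopology_ord_open by simp

lemma topspace_ord_topology: "topspace (ord_topology r) = Field r"
proof -
  have "ord_open r (Field r)"
    unfolding ord_open_def
  proof (intro conjI ballI)
    fix x assume x: "x \<in> Field r"
    show "(\<forall>y\<in>Field r. (x, y) \<in> r) \<or>
        (\<exists>a\<in>Field r. rless r a x \<and> {y \<in> Field r. rless r a y \<and> (y, x) \<in> r} \<subseteq> Field r)"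
      using x not_rless by blast
    show "(\<forall>y\<in>Field r. (y, x) \<in> r) \<or>
        (\<exists>b\<in>Field r. rless r x b \<and> {y \<in> Field r. (x, y) \<in> r \<and> rless r y b} \<subseteq> Field r)"
      using x not_rless by blast
  qed simp
  moreover have "U \<subseteq> Field r" if "ord_open r U" for U
    using that unfolding ord_open_def by blast
  ultimately show ?thesis
    unfolding topspace_def openin_ord_topology by blast
qed

text \<open>The point \<open>y\<close> certifies that \<open>x\<close> is not the least element,
  which excludes the degenerate alternative in \<open>ord_open\<close>.\<close>

lemma openin_left_neighbourhood:
  assumes "openin (ord_topology r) U" "x \<in> U" "rless r y x"
  obtains a where "rless r a x" "\<And>z. rless r a z \<Longrightarrow> (z, x) \<in> r \<Longrightarrow> z \<in> U"
proof -
  have "\<not> (x, y) \<in> r"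
    using assms(3) not_rless rless_Field by blast
  then obtain a where "rless r a x" "{y \<in> Field r. rless r a y \<and> (y, x) \<in> r} \<subseteq> U"
    using assms rless_Field[OF assms(3)] unfolding openin_ord_topology ord_open_def by blast
  then show ?thesis
    using that le_Field by blast
qed

text \<open>A closed initial segment is open because \<open>b\<close> has a successor: no point lies
  strictly between them.\<close>

lemma openin_initial_segment:
  assumes "b \<in> Field r"
  shows "openin (ord_topology r) {y. (y, b) \<in> r}"
  unfolding openin_ord_topology ord_open_def
proof (intro conjI ballI)
  show "{y. (y, b) \<in> r} \<subseteq> Field r"
    using le_Field by blast
  fix x assume "x \<in> {y. (y, b) \<in> r}"
  then have xb: "(x, b) \<in> r" and x: "x \<in> Field r"
    using le_Field by auto
  show "(\<forall>y\<in>Field r. (x, y) \<in> r) \<or>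
      (\<exists>a\<in>Field r. rless r a x \<and> {y \<in> Field r. rless r a y \<and> (y, x) \<in> r} \<subseteq> {y. (y, b) \<in> r})"
    using x xb not_rless le_trans by blast
  obtain c where "rless r b c" "\<And>z. rless r z c \<Longrightarrow> (z, b) \<in> r"
    using successor[OF assms] by blast
  then show "(\<forall>y\<in>Field r. (y, x) \<in> r) \<or>
      (\<exists>c\<in>Field r. rless r x c \<and> {y \<in> Field r. (x, y) \<in> r \<and> rless r y c} \<subseteq> {y. (y, b) \<in> r})"
    using xb le_rless_trans rless_Field by blast
qed

lemma openin_final_segment:
  assumes "b \<in> Field r"
  shows "openin (ord_topology r) {y. rless r b y}"
  unfolding openin_ord_topology ord_open_def
proof (intro conjI ballI)
  show "{y. rless r b y} \<subseteq> Field r"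
    using rless_Field by blast
  fix x assume "x \<in> {y. rless r b y}"
  then have bx: "rless r b x" and x: "x \<in> Field r"
    using rless_Field by auto
  show "(\<forall>y\<in>Field r. (x, y) \<in> r) \<or>
      (\<exists>a\<in>Field r. rless r a x \<and> {y \<in> Field r. rless r a y \<and> (y, x) \<in> r} \<subseteq> {y. rless r b y})"
    using bx assms by blast
  show "(\<forall>y\<in>Field r. (y, x) \<in> r) \<or>
      (\<exists>c\<in>Field r. rless r x c \<and> {y \<in> Field r. (x, y) \<in> r \<and> rless r y c} \<subseteq> {y. rless r b y})"
    using bx rless_le_trans no_maximum[OF x] rless_Field by blast
qed

section \<open>Clubs, stationary sets and pressing down\<close>

lemma club_closure_points:
  assumes \<beta>: "\<beta> \<in> Field r" and h: "\<And>x. x \<in> Field r \<Longrightarrow> h x \<in> Field r"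
  shows "club r {s. rless r \<beta> s \<and> (\<forall>\<delta>. rless r \<delta> s \<longrightarrow> rless r (h \<delta>) s)}" (is "club r ?C")
  unfolding club_def
proof (intro conjI ballI)
  show C: "?C \<subseteq> Field r"
    using rless_Field by blast
  \<comment> \<open>Closedness: a point violates the closure condition at a single
    \<open>\<delta>\<close>, and each such violation is an open condition on
    \<open>y\<close>.\<close>
  have "Field r - ?C = {y. (y, \<beta>) \<in> r} \<union> (\<Union>\<delta>\<in>Field r. {y. rless r \<delta> y} \<inter> {y. (y, h \<delta>) \<in> r})"
    (is "_ = ?U")
  proof (intro equalityI subsetI)
    fix y assume "y \<in> Field r - ?C"
    then have y: "y \<in> Field r" "\<not> rless r \<beta> y \<or> (\<exists>\<delta>. rless r \<delta> y \<and> \<not> rless r (h \<delta>) y)"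
      by auto
    then have "(y, \<beta>) \<in> r \<or> (\<exists>\<delta>\<in>Field r. rless r \<delta> y \<and> (y, h \<delta>) \<in> r)"
      using not_rless[OF \<beta> y(1)] not_rless[OF h y(1)] rless_Field(1) by metis
    then show "y \<in> ?U"
      by auto
  next
    fix y assume "y \<in> ?U"
    then have y: "y \<in> Field r" "(y, \<beta>) \<in> r \<or> (\<exists>\<delta>\<in>Field r. rless r \<delta> y \<and> (y, h \<delta>) \<in> r)"
      using le_Field by auto
    then have "\<not> rless r \<beta> y \<or> (\<exists>\<delta>. rless r \<delta> y \<and> \<not> rless r (h \<delta>) y)"
      using not_rless[OF \<beta> y(1)] not_rless[OF h y(1)] by metis
    then show "y \<in> Field r - ?C"
      using y(1) by blast
  qed
  moreover have "openin (ord_topology r) ?U"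
    using openin_initial_segment openin_final_segment \<beta> h by (intro openin_Un openin_Union) auto
  ultimately show "closedin (ord_topology r) ?C"
    using C unfolding closedin_def topspace_ord_topology by simp
  fix x assume x: "x \<in> Field r"
  obtain z0 where z0: "z0 \<in> {x, \<beta>}" "(x, z0) \<in> r" "(\<beta>, z0) \<in> r"
    using upper_pair[OF x \<beta>] by blast
  \<comment> \<open>Unboundedness: the points up to \<open>z\<close> lie strictly below some
    \<open>z'\<close>, so they are too few for their \<open>h\<close>-values to be cofinal.\<close>
  have step: "\<exists>w. rless r z w \<and> (\<forall>\<delta>. (\<delta>, z) \<in> r \<longrightarrow> rless r (h \<delta>) w)" if z: "z \<in> Field r" for z
  proof -
    obtain z' where z': "rless r z z'"
      using no_maximum[OF z] by blast
    have sub: "h ` {y. rless r y z'} \<subseteq> Field r"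
      using h rless_Field by blast
    obtain b where b: "b \<in> Field r" "\<And>\<delta>. rless r \<delta> z' \<Longrightarrow> rless r (h \<delta>) b"
      using strict_bound_image[OF sub card_below[OF rless_Field(2)[OF z']]] by (metis mem_Collect_eq)
    obtain w where w: "w \<in> {b, z'}" "(b, w) \<in> r" "(z', w) \<in> r"
      using upper_pair b z' rless_Field by metis
    show ?thesis
      using w b z' rless_le_trans le_rless_trans by blast
  qed
  then obtain n where n: "\<And>z. z \<in> Field r \<Longrightarrow> rless r z (n z)"
    "\<And>z \<delta>. z \<in> Field r \<Longrightarrow> (\<delta>, z) \<in> r \<Longrightarrow> rless r (h \<delta>) (n z)"
    by metis
  define f where "f k = (n ^^ k) z0" for k
  have f_Suc: "f (Suc k) = n (f k)" for k
    unfolding f_def by simp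
  have f: "f k \<in> Field r" for k
  proof (induction k)
    case 0
    show ?case
      using z0(2) le_Field unfolding f_def by simp
  next
    case (Suc k)
    then show ?case
      using n(1) rless_Field(2) unfolding f_Suc by blast
  qed
  obtain b where b: "b \<in> Field r" "\<And>k. rless r (f k) b"
    using strict_bound_image[of f UNIV] f countable_less by (metis UNIV_I countableI_type image_subsetI)
  \<comment> \<open>\<open>s\<close> is the supremum of the sequence \<open>f\<close>; leastness
    puts every \<open>\<delta>\<close> below \<open>s\<close> under some \<open>f k\<close>, and
    then \<open>h \<delta>\<close> lies below \<open>f (Suc k)\<close>.\<close>
  obtain s where s: "s \<in> {s. \<forall>k. rless r (f k) s}" "\<And>y. rless r y s \<Longrightarrow> y \<notin> {s. \<forall>k. rless r (f k) s}"
    using ex_least[of b "{s. \<forall>k. rless r (f k) s}"] b rless_Field by blast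
  have "rless r z0 s"
    using s(1) unfolding f_def by (metis (mono_tags) funpow_0 mem_Collect_eq)
  then have "rless r x s" "rless r \<beta> s"
    using z0 le_rless_trans by blast+
  moreover have "rless r (h \<delta>) s" if \<delta>: "rless r \<delta> s" for \<delta>
  proof -
    obtain k where "\<not> rless r (f k) \<delta>"
      using s(2) \<delta> by blast
    then have "(\<delta>, f k) \<in> r"
      using not_rless f rless_Field(1)[OF \<delta>] by blast
    then have "rless r (h \<delta>) (f (Suc k))"
      using n(2) f f_Suc by simp
    then show ?thesis
      using s(1) rless_trans by blast
  qed
  ultimately show "\<exists>y\<in>?C. rless r x y"
    by blast
qed

text \<open>The only clubs that have to be met are sets of closure points of a function, so
  stationarity is applied in this form from here on.\<close>

lemma stationary_closure_point:
  assumes "stationary r S" "\<beta> \<in> Field r" "\<And>x. x \<in> Field r \<Longrightarrow> h x \<in> Field r"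
  obtains s where "s \<in> S" "rless r \<beta> s" "\<And>\<delta>. rless r \<delta> s \<Longrightarrow> rless r (h \<delta>) s"
  using assms(1) club_closure_points[of \<beta> h, OF assms(2,3)] unfolding stationary_def by blast

lemma stationary_unbounded:
  assumes "stationary r S" "\<beta> \<in> Field r"
  obtains s where "s \<in> S" "rless r \<beta> s"
  using stationary_closure_point[OF assms, of "\<lambda>x. x"] by blast

text \<open>Let \<open>h\<close> send each point to a larger point of \<open>S\<close>. At a closure
  point \<open>s\<close> of \<open>h\<close>, the value \<open>h x\<close> is a point of
  \<open>S\<close> strictly between \<open>x\<close> and \<open>s\<close>.\<close>

lemma stationary_limit_point:
  assumes S: "stationary r S"
  obtains s where "s \<in> S" "\<exists>x. rless r x s" "\<And>x. rless r x s \<Longrightarrow> \<exists>y\<in>S. rless r x y \<and> rless r y s"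
proof -
  have "\<forall>x\<in>Field r. \<exists>y. y \<in> S \<and> rless r x y"
    using stationary_unbounded[OF S] by blast
  then obtain h where h: "\<And>x. x \<in> Field r \<Longrightarrow> h x \<in> S \<and> rless r x (h x)"
    by metis
  obtain x0 where x0: "x0 \<in> Field r"
    using infinite_Field infinite_imp_nonempty by blast
  show ?thesis
  proof (rule stationary_closure_point[OF S x0, of h])
    show "h x \<in> Field r" if "x \<in> Field r" for x
      using h[OF that] rless_Field by blast
  qed (use that h rless_Field in blast)
qed

text \<open>A weak form of Fodor's lemma: \<open>g\<close> is bounded on an unbounded set.
  Otherwise, for each \<open>\<delta>\<close>, the points \<open>t\<close> with \<open>g t\<close>
  at most \<open>\<delta>\<close> do not go beyond some \<open>h \<delta>\<close>; a closure point
  \<open>s\<close> of \<open>h\<close> contradicts this for \<open>\<delta> = g s\<close>. The base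
  point \<open>x0\<close> ensures that something lies below the arguments of
  \<open>g\<close>.\<close>

lemma pressing_down:
  assumes S: "stationary r S"
    and g: "\<And>s. s \<in> S \<Longrightarrow> rless r x0 s \<Longrightarrow> rless r (g s) s" and x0: "x0 \<in> Field r"
  obtains \<delta> where "\<delta> \<in> Field r"
    "\<And>x. x \<in> Field r \<Longrightarrow> \<exists>t\<in>S. rless r x t \<and> rless r x0 t \<and> (g t, \<delta>) \<in> r"
proof (rule ccontr)
  assume "\<not> thesis"
  then have "\<forall>\<delta>\<in>Field r. \<exists>x\<in>Field r. \<forall>t\<in>S. rless r x t \<and> rless r x0 t \<longrightarrow> (g t, \<delta>) \<notin> r"
    using that by blast
  then obtain h where h: "\<And>\<delta>. \<delta> \<in> Field r \<Longrightarrow> h \<delta> \<in> Field r"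
    "\<And>\<delta> t. \<delta> \<in> Field r \<Longrightarrow> t \<in> S \<Longrightarrow> rless r (h \<delta>) t \<Longrightarrow> rless r x0 t \<Longrightarrow> (g t, \<delta>) \<notin> r"
    by metis
  obtain s where s: "s \<in> S" "rless r x0 s" "\<And>\<delta>. rless r \<delta> s \<Longrightarrow> rless r (h \<delta>) s"
    using stationary_closure_point[OF S x0, of h] h(1) by blast
  have gs: "rless r (g s) s"
    using g s by blast
  then have "(g s, g s) \<notin> r"
    using h(2)[of "g s" s] s rless_Field by blast
  then show False
    using gs le_refl rless_Field by blast
qed

end

section \<open>Translations and neighbourhoods of the identity in a paratopological group\<close>

locale paratop_group =
  fixes G :: "('g, 'b) monoid_scheme" (structure) and T :: "'g topology"
  assumes para: "paratopological_group G T"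
begin

sublocale group G
  using para unfolding paratopological_group_def by blast

lemma topspace_carrier: "topspace T = carrier G"
  using para unfolding paratopological_group_def by blast

lemma mult_continuous: "continuous_map (prod_topology T T) T (\<lambda>(x, y). x \<otimes> y)"
  using para unfolding paratopological_group_def by blast

lemma left_translation_continuous:
  assumes "a \<in> carrier G"
  shows "continuous_map T T (\<lambda>x. a \<otimes> x)"
proof -
  have "continuous_map T (prod_topology T T) (\<lambda>x. (a, x))"
    using assms topspace_carrier by (intro continuous_map_pairedI) auto
  from continuous_map_compose[OF this mult_continuous] show ?thesis
    by (simp add: o_def)
qed

lemma right_translation_continuous:
  assumes "a \<in> carrier G"
  shows "continuous_map T T (\<lambda>x. x \<otimes> a)"
proof -
  have "continuous_map T (prod_topology T T) (\<lambda>x. (x, a))"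
    using assms topspace_carrier by (intro continuous_map_pairedI) auto
  from continuous_map_compose[OF this mult_continuous] show ?thesis
    by (simp add: o_def)
qed

lemma openin_left_preimage:
  "a \<in> carrier G \<Longrightarrow> openin T U \<Longrightarrow> openin T {x \<in> carrier G. a \<otimes> x \<in> U}"
  using openin_continuous_map_preimage[OF left_translation_continuous] topspace_carrier by fastforce

lemma openin_right_preimage:
  "a \<in> carrier G \<Longrightarrow> openin T U \<Longrightarrow> openin T {x \<in> carrier G. x \<otimes> a \<in> U}"
  using openin_continuous_map_preimage[OF right_translation_continuous] topspace_carrier by fastforce

text \<open>This is joint continuity at the pair of identities; it allows two small displacements to
  be composed into one controlled by \<open>W\<close>.\<close>

lemma square_root_neighbourhood:
  assumes "openin T W" "\<one> \<in> W"
  obtains V where "openin T V" "\<one> \<in> V" "\<And>x y. x \<in> V \<Longrightarrow> y \<in> V \<Longrightarrow> x \<otimes> y \<in> W"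
proof -
  let ?P = "{p \<in> topspace (prod_topology T T). (\<lambda>(x, y). x \<otimes> y) p \<in> W}"
  have "openin (prod_topology T T) ?P"
    using openin_continuous_map_preimage[OF mult_continuous assms(1)] .
  moreover have "(\<one>, \<one>) \<in> ?P"
    using assms(2) topspace_carrier by simp
  ultimately obtain U V where UV: "openin T U" "openin T V" "\<one> \<in> U" "\<one> \<in> V" "U \<times> V \<subseteq> ?P"
    unfolding openin_prod_topology_alt by meson
  show ?thesis
  proof (rule that[of "U \<inter> V"])
    show "x \<otimes> y \<in> W" if "x \<in> U \<inter> V" "y \<in> U \<inter> V" for x y
      using that UV(5) by auto
  qed (use UV in auto)
qed

text \<open>Otherwise some closed set \<open>H\<close>, an intersection of neighbourhoods
  of the identity, misses all \<open>a i\<close> and contains more than the identity; the sets \<open>H - {\<one>}\<close> and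
  \<open>{a i}\<close> are then separated, but \<open>a i \<otimes> h\<close> converges to \<open>h\<close>.\<close>

lemma pseudocharacter_le:
  assumes hn: "hereditarily normal_space T" and reg: "regular_space T" and t1: "t1_space T"
    and a: "\<And>i. i \<in> I \<Longrightarrow> a i \<in> carrier G"
    and J: "\<And>j. j \<in> I \<Longrightarrow> j \<in> J j" "\<And>j. j \<in> I \<Longrightarrow> J j \<subset> I"
    and apart: "\<And>j. j \<in> I \<Longrightarrow> \<one> \<notin> T closure_of (a ` J j)"
    and conv: "\<And>U. openin T U \<Longrightarrow> \<one> \<in> U \<Longrightarrow> \<exists>j\<in>I. a ` (I - J j) \<subseteq> U"
  obtains W where "\<And>i. i \<in> I \<Longrightarrow> openin T (W i) \<and> \<one> \<in> W i"
    "\<And>x. x \<in> carrier G \<Longrightarrow> (\<And>i. i \<in> I \<Longrightarrow> x \<in> W i) \<Longrightarrow> x = \<one>"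
proof -
  have haus: "Hausdorff_space T"
    using reg t1 by (rule regular_t1_imp_Hausdorff_space)
  have "\<exists>N. openin T N \<and> \<one> \<in> N \<and> disjnt (T closure_of (a ` J j)) (T closure_of N)" if "j \<in> I" for j
    using reg apart[OF that] topspace_carrier unfolding regular_space by simp
  then obtain N where N: "\<And>j. j \<in> I \<Longrightarrow> openin T (N j)" "\<And>j. j \<in> I \<Longrightarrow> \<one> \<in> N j"
    "\<And>j. j \<in> I \<Longrightarrow> disjnt (T closure_of (a ` J j)) (T closure_of (N j))"
    by metis
  \<comment> \<open>An empty index set would turn the intersection \<open>H\<close> into the whole
    type instead of a closed subset of the space.\<close>
  have "I \<noteq> {}"
    using conv[of "topspace T"] topspace_carrier openin_topspace[of T] by force
  define H where "H = (\<Inter>j\<in>I. T closure_of (N j))"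
  have closed_H: "closedin T H"
    unfolding H_def using \<open>I \<noteq> {}\<close> by auto
  have H_away: "x \<notin> H" if "j \<in> I" "x \<in> T closure_of (a ` J j)" for j x
    using that N(3)[OF that(1)] unfolding H_def disjnt_def by auto
  have aH: "a i \<notin> H" if "i \<in> I" for i
  proof -
    have "a ` J i \<subseteq> topspace T"
      using a J(2)[OF that] topspace_carrier by auto
    then show ?thesis
      using H_away[OF that] closure_of_subset[of "a ` J i" T] J(1)[OF that] by blast
  qed
  have sep: "separatedin T (H - {\<one>}) (a ` I)"
    unfolding separatedin_def
  proof (intro conjI)
    show "H - {\<one>} \<subseteq> topspace T"
      using closedin_subset[OF closed_H] by blast
    show "a ` I \<subseteq> topspace T"
      using a topspace_carrier by auto
    have "T closure_of (H - {\<one>}) \<subseteq> H"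
      using closed_H by (intro closure_of_minimal) auto
    then show "a ` I \<inter> T closure_of (H - {\<one>}) = {}"
      using aH by blast
    \<comment> \<open>Separate \<open>x\<close> from the identity. A tail of the family
      \<open>a\<close> lies near the identity, away from \<open>x\<close>, so \<open>x\<close> is in
      the closure of the remaining part, indexed by some \<open>J j\<close>; \<open>H\<close> avoids
      that closure.\<close>
    have False if x: "x \<in> H" "x \<noteq> \<one>" "x \<in> T closure_of (a ` I)" for x
    proof -
      obtain U V where UV: "openin T U" "openin T V" "x \<in> U" "\<one> \<in> V" "disjnt U V"
        using haus x closedin_subset[OF closed_H] topspace_carrier unfolding Hausdorff_space_def
        by (metis one_closed subsetD)
      obtain j where j: "j \<in> I" "a ` (I - J j) \<subseteq> V"
        using conv[OF UV(2,4)] by blast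
      have "a ` I = a ` J j \<union> a ` (I - J j)"
        using J(2)[OF j(1)] by blast
      then have "x \<in> T closure_of (a ` J j) \<or> x \<in> T closure_of V"
        using x(3) closure_of_mono[OF j(2), of T] by auto
      moreover have "x \<notin> T closure_of V"
        using UV unfolding in_closure_of disjnt_def by blast
      ultimately show False
        using H_away[OF j(1)] x(1) by blast
    qed
    then show "(H - {\<one>}) \<inter> T closure_of (a ` I) = {}"
      by blast
  qed
  obtain U V where UV: "openin T U" "openin T V" "H - {\<one>} \<subseteq> U" "a ` I \<subseteq> V" "disjnt U V"
    using hn sep unfolding hereditarily_normal_separation by meson
  show ?thesis
  \<comment> \<open>The first factor forces a common point \<open>h\<close> into \<open>H\<close>;
    the second keeps every \<open>a i \<otimes> h\<close> inside \<open>V\<close>, hence outside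
    \<open>U\<close>.\<close>
  proof (rule that[of "\<lambda>i. N i \<inter> {x \<in> carrier G. a i \<otimes> x \<in> V}"])
    show "openin T (N i \<inter> {x \<in> carrier G. a i \<otimes> x \<in> V}) \<and> \<one> \<in> N i \<inter> {x \<in> carrier G. a i \<otimes> x \<in> V}"
      if "i \<in> I" for i
      using that N a openin_left_preimage[OF a UV(2)] UV(4) by auto
  next
    fix h assume h: "h \<in> carrier G" and hW: "\<And>i. i \<in> I \<Longrightarrow> h \<in> N i \<inter> {x \<in> carrier G. a i \<otimes> x \<in> V}"
    show "h = \<one>"
    proof (rule ccontr)
      assume "h \<noteq> \<one>"
      moreover have "h \<in> T closure_of (N i)" if "i \<in> I" for i
        using hW[OF that] closure_of_subset[OF openin_subset[OF N(1)[OF that]]] by blast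
      ultimately have "h \<in> U"
        using UV(3) h topspace_carrier unfolding H_def by auto
      then have "openin T {x \<in> carrier G. x \<otimes> h \<in> U}" "\<one> \<in> {x \<in> carrier G. x \<otimes> h \<in> U}"
        using openin_right_preimage[OF h UV(1)] h by auto
      then obtain j where j: "j \<in> I" "a ` (I - J j) \<subseteq> {x \<in> carrier G. x \<otimes> h \<in> U}"
        using conv by blast
      \<comment> \<open>The tail is nonempty because \<open>J j\<close> is a proper subset of
        \<open>I\<close>.\<close>
      then obtain i where "i \<in> I" "a i \<otimes> h \<in> U"
        using J(2)[OF j(1)] by blast
      then show False
        using hW UV(5) unfolding disjnt_def by blast
    qed
  qed
qed

section \<open>Stationary subspaces of a paratopological group\<close>

lemma not_hereditarily_normal:
  assumes tych: "tychonoff_space T"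
    and kappa: "regular_uncountable_cardinal r"
    and stat: "stationary r S"
    and Ysub: "Y \<subseteq> topspace T"
    and hom: "subtopology T Y homeomorphic_space subtopology (ord_topology r) S"
  shows "\<not> hereditarily normal_space T"
proof
  assume hn: "hereditarily normal_space T"
  interpret regular_uncountable r
    using kappa by unfold_locales
  have reg: "regular_space T" and t1: "t1_space T"
    using tych completely_regular_imp_regular_space unfolding tychonoff_space_def by auto
  have S: "S \<subseteq> Field r"
    using stat unfolding stationary_def by blast
  obtain \<psi> \<phi> where hm: "homeomorphic_maps (subtopology T Y) (subtopology (ord_topology r) S) \<psi> \<phi>"
    using hom unfolding homeomorphic_space_def by blast
  have tops: "topspace (subtopology (ord_topology r) S) = S"
    using S topspace_ord_topology by auto
  have topsY: "topspace (subtopology T Y) = Y"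
    using Ysub by auto
  have contYS: "continuous_map (subtopology T Y) (subtopology (ord_topology r) S) \<psi>"
    and "continuous_map (subtopology (ord_topology r) S) (subtopology T Y) \<phi>"
    and \<psi>\<phi>: "\<And>s. s \<in> S \<Longrightarrow> \<psi> (\<phi> s) = s"
    using hm tops unfolding homeomorphic_maps_def by auto
  then have \<phi>: "continuous_map (subtopology (ord_topology r) S) T \<phi>" and \<phi>Y: "\<phi> ` S \<subseteq> Y"
    using tops Ysub unfolding continuous_map_in_subtopology by auto
  then have \<phi>_carrier: "\<phi> s \<in> carrier G" if "s \<in> S" for s
    using that Ysub topspace_carrier by blast

  \<comment> \<open>The condition on \<open>u\<close> says that \<open>\<phi> u\<close> lies in the
    translate of \<open>V\<close> by \<open>\<phi> t\<close>. Its preimage in \<open>S\<close> is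
    open because left multiplication by the fixed element \<open>inv (\<phi> t)\<close> is
    continuous.\<close>
  have left_nbhd: "\<exists>b. rless r b t \<and> (\<forall>u\<in>S. rless r b u \<longrightarrow> (u, t) \<in> r \<longrightarrow> inv (\<phi> t) \<otimes> \<phi> u \<in> V)"
    if t: "t \<in> S" "rless r y t" and V: "openin T V" "\<one> \<in> V" for t y V
  proof -
    have "openin T {x \<in> carrier G. inv (\<phi> t) \<otimes> x \<in> V}"
      using openin_left_preimage \<phi>_carrier[OF t(1)] V by blast
    then have "openin (subtopology (ord_topology r) S) {u \<in> S. \<phi> u \<in> {x \<in> carrier G. inv (\<phi> t) \<otimes> x \<in> V}}"
      using openin_continuous_map_preimage[OF \<phi>] unfolding tops by blast
    then obtain O' where O': "openin (ord_topology r) O'"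
      "{u \<in> S. \<phi> u \<in> {x \<in> carrier G. inv (\<phi> t) \<otimes> x \<in> V}} = O' \<inter> S"
      unfolding openin_subtopology by blast
    have "t \<in> O'"
      using O'(2) t V \<phi>_carrier by auto
    then obtain b where "rless r b t" "\<And>z. rless r b z \<Longrightarrow> (z, t) \<in> r \<Longrightarrow> z \<in> O'"
      using openin_left_neighbourhood O'(1) t(2) by blast
    then show ?thesis
      using O'(2) by blast
  qed

  obtain s0 where s0: "s0 \<in> S" "\<exists>x. rless r x s0"
    "\<And>x. rless r x s0 \<Longrightarrow> \<exists>y\<in>S. rless r x y \<and> rless r y s0"
    using stationary_limit_point[OF stat] by blast
  \<comment> \<open>Data for \<open>pseudocharacter_le\<close>: the translation in \<open>a\<close>
    moves the limit \<open>\<phi> s0\<close> to the identity, and the sets \<open>J j\<close> are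
    the initial parts of \<open>I\<close>, which lies in a proper initial segment and so is
    \<open>small\<close>.\<close>
  define I where "I = {t \<in> S. rless r t s0}"
  define J where "J j = {t \<in> S. (t, j) \<in> r}" for j
  define a where "a t = inv (\<phi> s0) \<otimes> \<phi> t" for t
  have small: "|I| <o r"
    using card_below S s0(1) card_of_mono1[of I "{y. rless r y s0}"] ordLeq_ordLess_trans
    unfolding I_def by blast
  have "\<exists>W. (\<forall>i\<in>I. openin T (W i) \<and> \<one> \<in> W i) \<and> (\<forall>x\<in>carrier G. (\<forall>i\<in>I. x \<in> W i) \<longrightarrow> x = \<one>)"
  proof (rule pseudocharacter_le[OF hn reg t1, of I a J])
    show "a i \<in> carrier G" if "i \<in> I" for i
      using that \<phi>_carrier s0(1) unfolding a_def I_def by auto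
    show "j \<in> J j" if "j \<in> I" for j
      using that le_refl S unfolding I_def J_def by blast
    show "J j \<subset> I" if j: "j \<in> I" for j
    proof -
      have "J j \<subseteq> I"
        using j le_rless_trans unfolding I_def J_def by blast
      moreover obtain y where "y \<in> S" "rless r j y" "rless r y s0"
        using s0(3) j unfolding I_def by blast
      ultimately show ?thesis
        using not_rless rless_Field unfolding I_def J_def by blast
    qed
    show "\<exists>j\<in>I. a ` (I - J j) \<subseteq> U" if U: "openin T U" "\<one> \<in> U" for U
    proof -
      obtain x where "rless r x s0"
        using s0(2) by blast
      then obtain b where b: "rless r b s0"
        "\<And>u. u \<in> S \<Longrightarrow> rless r b u \<Longrightarrow> (u, s0) \<in> r \<Longrightarrow> inv (\<phi> s0) \<otimes> \<phi> u \<in> U"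
        using left_nbhd[OF s0(1) _ U] by blast
      obtain j where j: "j \<in> S" "rless r b j" "rless r j s0"
        using s0(3)[OF b(1)] by blast
      have "a t \<in> U" if "t \<in> I - J j" for t
      proof -
        have "t \<in> S" "rless r t s0" "(t, j) \<notin> r"
          using that unfolding I_def J_def by auto
        then have "rless r j t" "(t, s0) \<in> r"
          using not_rless[of j t] rless_Field j(3) rless_imp_le by blast+
        then have "rless r b t"
          using j(2) rless_trans by blast
        then show ?thesis
          using b(2) \<open>t \<in> S\<close> \<open>(t, s0) \<in> r\<close> unfolding a_def by blast
      qed
      then show ?thesis
        using j unfolding I_def by blast
    qed
    \<comment> \<open>Continuity of \<open>\<psi>\<close> enters here: the points of
      \<open>S\<close> above \<open>j\<close> form an open set, which is the trace on
      \<open>Y\<close> of an open \<open>Q\<close>. Translating \<open>Q\<close> back gives a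
      neighbourhood of the identity that misses the image of \<open>J j\<close>.\<close>
    show "\<one> \<notin> T closure_of (a ` J j)" if j: "j \<in> I" for j
    proof -
      have "openin (subtopology (ord_topology r) S) ({y. rless r j y} \<inter> S)"
        using openin_final_segment j S unfolding I_def openin_subtopology by blast
      then have "openin (subtopology T Y) {y \<in> Y. \<psi> y \<in> {y. rless r j y} \<inter> S}"
        using openin_continuous_map_preimage[OF contYS] unfolding topsY by blast
      then obtain Q where Q: "openin T Q" "{y \<in> Y. \<psi> y \<in> {y. rless r j y} \<inter> S} = Q \<inter> Y"
        unfolding openin_subtopology by blast
      let ?Q = "{x \<in> carrier G. \<phi> s0 \<otimes> x \<in> Q}"
      have "\<phi> s0 \<in> Q"
      proof -
        have "\<phi> s0 \<in> {y \<in> Y. \<psi> y \<in> {y. rless r j y} \<inter> S}"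
          using j s0(1) \<phi>Y \<psi>\<phi> unfolding I_def by auto
        then show ?thesis
          using Q(2) by blast
      qed
      then have "openin T ?Q" "\<one> \<in> ?Q"
        using openin_left_preimage Q(1) \<phi>_carrier[OF s0(1)] by auto
      have "a t \<notin> ?Q" if t: "t \<in> J j" for t
      proof
        have tS: "t \<in> S"
          using t unfolding J_def by blast
        assume "a t \<in> ?Q"
        then have "\<phi> t \<in> Q"
          using \<phi>_carrier[OF tS] \<phi>_carrier[OF s0(1)] unfolding a_def by (simp add: m_assoc[symmetric])
        then have "\<phi> t \<in> {y \<in> Y. \<psi> y \<in> {y. rless r j y} \<inter> S}"
          using Q(2) tS \<phi>Y by blast
        then have "rless r j t"
          using tS \<psi>\<phi> by auto
        then have "rless r j j"
          using t rless_le_trans unfolding J_def by blast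
        then show False
          using rless_irrefl by blast
      qed
      then have "?Q \<inter> a ` J j = {}"
        by blast
      then have "?Q \<inter> T closure_of (a ` J j) = {}"
        using openin_Int_closure_of_eq_empty[OF \<open>openin T ?Q\<close>] by blast
      then show ?thesis
        using \<open>\<one> \<in> ?Q\<close> by blast
    qed
  next
    fix W
    assume "\<And>i. i \<in> I \<Longrightarrow> openin T (W i) \<and> \<one> \<in> W i"
      "\<And>x. x \<in> carrier G \<Longrightarrow> (\<And>i. i \<in> I \<Longrightarrow> x \<in> W i) \<Longrightarrow> x = \<one>"
    then show "\<exists>W. (\<forall>i\<in>I. openin T (W i) \<and> \<one> \<in> W i) \<and> (\<forall>x\<in>carrier G. (\<forall>i\<in>I. x \<in> W i) \<longrightarrow> x = \<one>)"
      by (intro exI[of _ W]) simp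
  qed
  then obtain W where W: "\<And>i. i \<in> I \<Longrightarrow> openin T (W i)" "\<And>i. i \<in> I \<Longrightarrow> \<one> \<in> W i"
    "\<And>x. x \<in> carrier G \<Longrightarrow> \<forall>i\<in>I. x \<in> W i \<Longrightarrow> x = \<one>"
    by metis
  have "\<exists>V. openin T V \<and> \<one> \<in> V \<and> (\<forall>x\<in>V. \<forall>y\<in>V. x \<otimes> y \<in> W i)" if i: "i \<in> I" for i
    using square_root_neighbourhood[OF W(1)[OF i] W(2)[OF i]] by metis
  then obtain V where V: "\<And>i. i \<in> I \<Longrightarrow> openin T (V i)" "\<And>i. i \<in> I \<Longrightarrow> \<one> \<in> V i"
    "\<And>i x y. i \<in> I \<Longrightarrow> x \<in> V i \<Longrightarrow> y \<in> V i \<Longrightarrow> x \<otimes> y \<in> W i"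
    by metis

  obtain x0 where x0: "x0 \<in> Field r"
    using S s0(1) by blast
  \<comment> \<open>For each \<open>i\<close>, the left endpoint \<open>g i t\<close> supplied by
    \<open>left_nbhd\<close> for \<open>V i\<close> is a regressive function of \<open>t\<close>,
    ready for pressing down.\<close>
  obtain g where g: "\<And>i t. i \<in> I \<Longrightarrow> t \<in> S \<Longrightarrow> rless r x0 t \<Longrightarrow> rless r (g i t) t"
    "\<And>i t u. i \<in> I \<Longrightarrow> t \<in> S \<Longrightarrow> rless r x0 t \<Longrightarrow> u \<in> S \<Longrightarrow> rless r (g i t) u \<Longrightarrow> (u, t) \<in> r
      \<Longrightarrow> inv (\<phi> t) \<otimes> \<phi> u \<in> V i"
  proof -
    have "\<forall>i\<in>I. \<forall>t\<in>S. \<exists>b. rless r x0 t \<longrightarrow>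
        rless r b t \<and> (\<forall>u\<in>S. rless r b u \<longrightarrow> (u, t) \<in> r \<longrightarrow> inv (\<phi> t) \<otimes> \<phi> u \<in> V i)"
      using left_nbhd[OF _ _ V(1,2)] by metis
    then show ?thesis
      using that by metis
  qed
  have "\<exists>\<delta>\<in>Field r. \<forall>x\<in>Field r. \<exists>t\<in>S. rless r x t \<and> rless r x0 t \<and> (g i t, \<delta>) \<in> r" if "i \<in> I" for i
    using pressing_down[OF stat g(1)[OF that] x0] by metis
  then obtain d where d: "\<And>i. i \<in> I \<Longrightarrow> d i \<in> Field r"
    "\<And>i x. i \<in> I \<Longrightarrow> x \<in> Field r \<Longrightarrow> \<exists>t\<in>S. rless r x t \<and> rless r x0 t \<and> (g i t, d i) \<in> r"
    by metis
  \<comment> \<open>\<open>q i x\<close> chooses a point beyond \<open>x\<close> whose left endpoint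
    for \<open>V i\<close> is at most \<open>d i\<close>.\<close>
  then obtain q where q: "\<And>i x. i \<in> I \<Longrightarrow> x \<in> Field r \<Longrightarrow>
      q i x \<in> S \<and> rless r x (q i x) \<and> rless r x0 (q i x) \<and> (g i (q i x), d i) \<in> r"
    by metis
  \<comment> \<open>Regularity applies since \<open>I\<close> is smaller than the cardinal: one
    \<open>\<delta>\<close> exceeds all the bounds \<open>d i\<close>.\<close>
  obtain \<delta> where \<delta>: "\<delta> \<in> Field r" "\<And>i. i \<in> I \<Longrightarrow> rless r (d i) \<delta>"
    using strict_bound_image[of d I] d(1) small by blast
  obtain u where u: "u \<in> S" "rless r \<delta> u"
    using stationary_unbounded[OF stat \<delta>(1)] by blast
  \<comment> \<open>Bounding \<open>q i x\<close> over all \<open>i\<close> at once gives a single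
    function \<open>h\<close>; below a closure point \<open>s\<close> of \<open>h\<close>, the
    values of \<open>q i\<close> are unbounded in \<open>s\<close> for every \<open>i\<close>
    simultaneously.\<close>
  have "\<exists>b\<in>Field r. \<forall>i\<in>I. rless r (q i x) b" if x: "x \<in> Field r" for x
    using strict_bound_image[of "\<lambda>i. q i x" I] q[OF _ x] S small by (metis image_subsetI subsetD)
  then obtain h where h: "\<And>x. x \<in> Field r \<Longrightarrow> h x \<in> Field r"
    "\<And>x i. x \<in> Field r \<Longrightarrow> i \<in> I \<Longrightarrow> rless r (q i x) (h x)"
    by metis
  obtain \<beta> where \<beta>: "\<beta> \<in> {u, x0}" "(u, \<beta>) \<in> r" "(x0, \<beta>) \<in> r"
    using upper_pair x0 u(1) S by blast
  then have "\<beta> \<in> Field r"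
    using le_Field by blast
  then obtain s where s: "s \<in> S" "rless r \<beta> s" "\<And>x. rless r x s \<Longrightarrow> rless r (h x) s"
    using stationary_closure_point[OF stat, of \<beta> h] h(1) by blast
  have us: "rless r u s" and x0s: "rless r x0 s"
    using \<beta> s(2) le_rless_trans by blast+
  have carr: "\<phi> u \<in> carrier G" "\<phi> s \<in> carrier G"
    using \<phi>_carrier u s by auto
  have "inv (\<phi> s) \<otimes> \<phi> u \<in> W i" if i: "i \<in> I" for i
  proof -
    have gs: "rless r (g i s) s"
      using g(1)[OF i s(1) x0s] .
    \<comment> \<open>Starting from the maximum of \<open>g i s\<close> and \<open>u\<close> places
      \<open>t = q i x\<close> after \<open>u\<close> and within the range controlled by
      \<open>V i\<close> at \<open>s\<close>.\<close>
    obtain x where x: "x \<in> {g i s, u}" "(g i s, x) \<in> r" "(u, x) \<in> r"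
      using upper_pair gs us rless_Field by metis
    then have xs: "rless r x s" and xF: "x \<in> Field r"
      using gs us rless_Field by auto
    define t where "t = q i x"
    have t: "t \<in> S" "rless r x t" "rless r x0 t" "(g i t, d i) \<in> r"
      using q[OF i xF] unfolding t_def by auto
    have ts: "rless r t s"
      using h(2)[OF xF i] s(3)[OF xs] rless_trans unfolding t_def by blast
    have "inv (\<phi> s) \<otimes> \<phi> t \<in> V i"
      using g(2)[OF i s(1) x0s t(1)] le_rless_trans[OF x(2) t(2)] rless_imp_le[OF ts] by blast
    \<comment> \<open>Here the choice of \<open>u\<close> pays off: \<open>g i t\<close> is at most
      \<open>d i\<close>, which is below \<open>\<delta>\<close> and thus below \<open>u\<close>, so
      \<open>u\<close> lies in the range controlled by \<open>V i\<close> at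
      \<open>t\<close>.\<close>
    moreover have "rless r (g i t) u"
      using le_rless_trans[OF t(4)] \<delta>(2)[OF i] u(2) rless_trans by blast
    then have "inv (\<phi> t) \<otimes> \<phi> u \<in> V i"
      using g(2)[OF i t(1) t(3) u(1)] rless_imp_le le_rless_trans[OF x(3) t(2)] by blast
    ultimately have "(inv (\<phi> s) \<otimes> \<phi> t) \<otimes> (inv (\<phi> t) \<otimes> \<phi> u) \<in> W i"
      using V(3)[OF i] by blast
    moreover have "(inv (\<phi> s) \<otimes> \<phi> t) \<otimes> (inv (\<phi> t) \<otimes> \<phi> u) = inv (\<phi> s) \<otimes> \<phi> u"
      using \<phi>_carrier[OF t(1)] carr by (metis inv_closed inv_solve_left m_assoc m_closed)
    ultimately show ?thesis
      by simp
  qed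
  then have "inv (\<phi> s) \<otimes> \<phi> u = \<one>"
    using W(3) carr by simp
  then have "\<phi> u = \<phi> s"
    using carr by (metis inv_closed inv_equality inv_inv)
  \<comment> \<open>\<open>\<phi>\<close> is injective on \<open>S\<close> because
    \<open>\<psi>\<close> inverts it there.\<close>
  then have "u = s"
    using \<psi>\<phi> u(1) s(1) by metis
  then show False
    using us rless_irrefl by blast
qed

end

theorem theorem2p5:
  fixes G :: "('g, 'b) monoid_scheme" and T :: "'g topology"
    and r :: "'k rel" and S :: "'k set" and Y :: "'g set"
  assumes GCH: "GCH_on (UNIV :: ('g + 'k) set set set)"
    and para: "paratopological_group G T"
    and tych: "tychonoff_space T"
    and kappa: "regular_uncountable_cardinal r"
    and stat: "stationary r S"
    and Ysub: "Y \<subseteq> topspace T"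
    and hom: "subtopology T Y homeomorphic_space subtopology (ord_topology r) S"
  shows "\<not> hereditarily normal_space T"
proof -
  interpret paratop_group G T
    using para by unfold_locales
  show ?thesis
    using tych kappa stat Ysub hom by (rule not_hereditarily_normal)
qed

end
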